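(* Let $(M,J,\nabla,\omega)$ be a special symplectic manifold and $\omega=\omega^{11}+\omega^{20}+\omega^{02}$ the Hodge decomposition of the symplectic form. Then each of the components $\omega^{11},\omega^{20},\omega^{02}$ is closed.
   Context: A special symplectic manifold $(M,J,\nabla,\omega)$ is a complex manifold $(M,J)$ together with a flat torsionfree connection $\nabla$ on its real tangent bundle such that $d^\nabla J=0$, i.e. $(\nabla_XJ)Y=(\nabla_YJ)X$ for all $X,Y$, and a $\nabla$-parallel symplectic form $\omega$ (not assumed $J$-invariant). The Hodge decomposition is the decomposition into components of type $(1,1),(2,0),(0,2)$ with respect to $J$. *)

theory Defs
  imports "HOL-Analysis.Analysis"
begin

section \<open>Smooth and holomorphic maps between open sets of vector spaces\<close>

text \<open>Meant for open \<open>S\<close>; the derivatives are real Frechet derivatives.\<close>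

primrec Ck_on :: "nat \<Rightarrow> ('a::euclidean_space \<Rightarrow> 'b::real_normed_vector) \<Rightarrow> 'a set \<Rightarrow> bool" where
  "Ck_on 0 f S \<longleftrightarrow> continuous_on S f"
| "Ck_on (Suc k) f S \<longleftrightarrow>
     (\<forall>x\<in>S. f differentiable (at x)) \<and>
     (\<forall>v. Ck_on k (\<lambda>x. frechet_derivative f (at x) v) S)"

definition smooth_on :: "('a::euclidean_space \<Rightarrow> 'b::real_normed_vector) \<Rightarrow> 'a set \<Rightarrow> bool" where
  "smooth_on f S \<longleftrightarrow> (\<forall>k. Ck_on k f S)"

text \<open>Holomorphic in several variables: real differentiable with complex linear derivative.\<close>

definition holomorphic_map_on :: "(complex^'n \<Rightarrow> complex^'k) \<Rightarrow> (complex^'n) set \<Rightarrow> bool" where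
  "holomorphic_map_on f S \<longleftrightarrow>
     (\<forall>x\<in>S. \<exists>D. (f has_derivative D) (at x) \<and> (\<forall>c v. D (c *s v) = c *s D v))"


section \<open>Complex manifolds\<close>

text \<open>A chart is a pair of its domain and its coordinate map; the values of the coordinate map
  outside the domain are irrelevant.\<close>

type_synonym ('m, 'n) chart = "'m set \<times> ('m \<Rightarrow> complex^'n)"

abbreviation chart_dom :: "('m, 'n) chart \<Rightarrow> 'm set" where
  "chart_dom c \<equiv> fst c"

abbreviation chart_map :: "('m, 'n) chart \<Rightarrow> 'm \<Rightarrow> complex^'n" where
  "chart_map c \<equiv> snd c"

definition chart_img :: "('m, 'n) chart \<Rightarrow> (complex^'n) set" where
  "chart_img c = chart_map c ` chart_dom c"

definition chart_inv :: "('m, 'n) chart \<Rightarrow> complex^'n \<Rightarrow> 'm" where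
  "chart_inv c = inv_into (chart_dom c) (chart_map c)"

definition is_chart :: "'m topology \<Rightarrow> ('m, 'n::finite) chart \<Rightarrow> bool" where
  "is_chart M c \<longleftrightarrow>
     openin M (chart_dom c) \<and> open (chart_img c) \<and>
     homeomorphic_map (subtopology M (chart_dom c)) (top_of_set (chart_img c)) (chart_map c)"

text \<open>A tangent vector at \<open>p\<close> is given by its coordinate vectors in all charts around \<open>p\<close>, which
  are related by the derivatives of the coordinate changes.  For the charts that do not contain
  \<open>p\<close> the value is \<open>0\<close>, so that equality of tangent vectors is equality of functions.\<close>

type_synonym ('m, 'n) tvec = "('m, 'n) chart \<Rightarrow> complex^'n"

definition tv_zero :: "('m, 'n::finite) tvec" where
  "tv_zero = (\<lambda>c. 0)"

definition tv_add :: "('m, 'n::finite) tvec \<Rightarrow> ('m, 'n::finite) tvec \<Rightarrow> ('m, 'n::finite) tvec" where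
  "tv_add u v = (\<lambda>c. u c + v c)"

definition tv_scale :: "real \<Rightarrow> ('m, 'n::finite) tvec \<Rightarrow> ('m, 'n::finite) tvec" where
  "tv_scale r u = (\<lambda>c. r *\<^sub>R u c)"

text \<open>The complex structure \<open>J\<close> is multiplication by \<open>\<i>\<close> in every holomorphic chart.\<close>

definition tv_J :: "('m, 'n::finite) tvec \<Rightarrow> ('m, 'n::finite) tvec" where
  "tv_J u = (\<lambda>c. \<i> *s u c)"

type_synonym ('m, 'n) vfield = "'m \<Rightarrow> ('m, 'n) tvec"

definition vf_zero :: "('m, 'n::finite) vfield" where
  "vf_zero = (\<lambda>p. tv_zero)"

definition vf_add :: "('m, 'n::finite) vfield \<Rightarrow> ('m, 'n::finite) vfield \<Rightarrow> ('m, 'n::finite) vfield" where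
  "vf_add X Y = (\<lambda>p. tv_add (X p) (Y p))"

definition vf_diff :: "('m, 'n::finite) vfield \<Rightarrow> ('m, 'n::finite) vfield \<Rightarrow> ('m, 'n::finite) vfield" where
  "vf_diff X Y = (\<lambda>p. tv_add (X p) (tv_scale (-1) (Y p)))"

definition vf_scale :: "('m \<Rightarrow> real) \<Rightarrow> ('m, 'n::finite) vfield \<Rightarrow> ('m, 'n::finite) vfield" where
  "vf_scale f X = (\<lambda>p. tv_scale (f p) (X p))"

definition vf_J :: "('m, 'n::finite) vfield \<Rightarrow> ('m, 'n::finite) vfield" where
  "vf_J X = (\<lambda>p. tv_J (X p))"

text \<open>A 2-form with values in \<open>'b\<close> (which is \<^typ>\<open>real\<close> or \<^typ>\<open>complex\<close> below).
  Only its values on tangent vectors at points of the manifold matter.\<close>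

type_synonym ('m, 'n, 'b) form2 = "'m \<Rightarrow> ('m, 'n) tvec \<Rightarrow> ('m, 'n) tvec \<Rightarrow> 'b"

locale complex_manifold =
  fixes M :: "'m topology" and A :: "('m, 'n::finite) chart set"
  assumes Hausdorff: "Hausdorff_space M"
    and second_countable: "second_countable M"
    and charts: "c \<in> A \<Longrightarrow> is_chart M c"
    and cover: "topspace M = (\<Union>c\<in>A. chart_dom c)"
    and holomorphic_transition:
      "c \<in> A \<Longrightarrow> d \<in> A \<Longrightarrow>
         holomorphic_map_on (chart_map d \<circ> chart_inv c) (chart_map c ` (chart_dom c \<inter> chart_dom d))"
begin

definition tangent_space :: "'m \<Rightarrow> ('m, 'n) tvec set" where
  "tangent_space p =
     {v. (\<forall>c\<in>A. \<forall>d\<in>A. p \<in> chart_dom c \<and> p \<in> chart_dom d \<longrightarrow>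
            v d = frechet_derivative (chart_map d \<circ> chart_inv c) (at (chart_map c p)) (v c)) \<and>
         (\<forall>c. \<not> (c \<in> A \<and> p \<in> chart_dom c) \<longrightarrow> v c = 0)}"

definition smooth_function :: "('m \<Rightarrow> 'b::real_normed_vector) \<Rightarrow> bool" where
  "smooth_function f \<longleftrightarrow> (\<forall>c\<in>A. smooth_on (f \<circ> chart_inv c) (chart_img c))"

text \<open>Smooth vector fields on \<open>M\<close>, extended by \<open>0\<close> outside of \<open>M\<close> so that they are equal iff
  they are equal as functions.\<close>

definition vector_fields :: "('m, 'n) vfield set" where
  "vector_fields =
     {X. (\<forall>p\<in>topspace M. X p \<in> tangent_space p) \<and>
         (\<forall>p. p \<notin> topspace M \<longrightarrow> X p = tv_zero) \<and>
         (\<forall>c\<in>A. smooth_on (\<lambda>x. X (chart_inv c x) c) (chart_img c))}"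

text \<open>The derivative \<open>X f\<close>, computed in an arbitrary chart (by the chain rule the choice does not
  matter if \<open>f\<close> is smooth and \<open>X p\<close> is a tangent vector).\<close>

definition vf_deriv :: "('m, 'n) vfield \<Rightarrow> ('m \<Rightarrow> 'b::real_normed_vector) \<Rightarrow> 'm \<Rightarrow> 'b" where
  "vf_deriv X f p =
     (let c = (SOME c. c \<in> A \<and> p \<in> chart_dom c)
      in frechet_derivative (f \<circ> chart_inv c) (at (chart_map c p)) (X p c))"

definition lie_bracket :: "('m, 'n) vfield \<Rightarrow> ('m, 'n) vfield \<Rightarrow> ('m, 'n) vfield" where
  "lie_bracket X Y = (\<lambda>p c.
     if c \<in> A \<and> p \<in> chart_dom c
     then frechet_derivative (\<lambda>x. Y (chart_inv c x) c) (at (chart_map c p)) (X p c)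
        - frechet_derivative (\<lambda>x. X (chart_inv c x) c) (at (chart_map c p)) (Y p c)
     else 0)"


subsection \<open>Differential forms of degree 2\<close>

definition two_form :: "('m, 'n, 'b::real_normed_vector) form2 \<Rightarrow> bool" where
  "two_form w \<longleftrightarrow>
     (\<forall>p\<in>topspace M.
        (\<forall>u\<in>tangent_space p. \<forall>u'\<in>tangent_space p. \<forall>v\<in>tangent_space p.
            w p (tv_add u u') v = w p u v + w p u' v) \<and>
        (\<forall>r. \<forall>u\<in>tangent_space p. \<forall>v\<in>tangent_space p.
            w p (tv_scale r u) v = r *\<^sub>R w p u v) \<and>
        (\<forall>u\<in>tangent_space p. \<forall>v\<in>tangent_space p. w p u v = - w p v u)) \<and>
     (\<forall>X\<in>vector_fields. \<forall>Y\<in>vector_fields. smooth_function (\<lambda>p. w p (X p) (Y p)))"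

definition ext_deriv :: "('m, 'n, 'b::real_normed_vector) form2 \<Rightarrow>
    ('m, 'n) vfield \<Rightarrow> ('m, 'n) vfield \<Rightarrow> ('m, 'n) vfield \<Rightarrow> 'm \<Rightarrow> 'b" where
  "ext_deriv w X Y Z p =
       vf_deriv X (\<lambda>q. w q (Y q) (Z q)) p
     - vf_deriv Y (\<lambda>q. w q (X q) (Z q)) p
     + vf_deriv Z (\<lambda>q. w q (X q) (Y q)) p
     - w p (lie_bracket X Y p) (Z p)
     + w p (lie_bracket X Z p) (Y p)
     - w p (lie_bracket Y Z p) (X p)"

definition closed_form :: "('m, 'n, 'b::real_normed_vector) form2 \<Rightarrow> bool" where
  "closed_form w \<longleftrightarrow>
     (\<forall>X\<in>vector_fields. \<forall>Y\<in>vector_fields. \<forall>Z\<in>vector_fields. \<forall>p\<in>topspace M.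
        ext_deriv w X Y Z p = 0)"

definition symplectic_form :: "('m, 'n, real) form2 \<Rightarrow> bool" where
  "symplectic_form w \<longleftrightarrow>
     two_form w \<and> closed_form w \<and>
     (\<forall>p\<in>topspace M. \<forall>u\<in>tangent_space p.
        (\<forall>v\<in>tangent_space p. w p u v = 0) \<longrightarrow> u = tv_zero)"


subsection \<open>Types of complex-valued 2-forms\<close>

text \<open>An element \<open>u + \<i> v\<close> of the complexified tangent space is represented by the pair \<open>(u, v)\<close>
  of real tangent vectors.  \<open>tangent_type k p\<close> is \<open>T\<^sup>1\<^sup>,\<^sup>0 = {u - \<i> J u}\<close>, the \<open>\<i>\<close>-eigenspace
  of \<open>J\<close>, for \<open>k = 1\<close> and \<open>T\<^sup>0\<^sup>,\<^sup>1 = {u + \<i> J u}\<close>, the \<open>-\<i>\<close>-eigenspace, for \<open>k = 0\<close>.\<close>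

definition tangent_type :: "nat \<Rightarrow> 'm \<Rightarrow> (('m, 'n) tvec \<times> ('m, 'n) tvec) set" where
  "tangent_type k p =
     (if k = 1 then (\<lambda>u. (u, tv_scale (-1) (tv_J u))) ` tangent_space p
      else (\<lambda>u. (u, tv_J u)) ` tangent_space p)"

definition complex_extension :: "('m, 'n, complex) form2 \<Rightarrow> 'm \<Rightarrow>
    ('m, 'n) tvec \<times> ('m, 'n) tvec \<Rightarrow> ('m, 'n) tvec \<times> ('m, 'n) tvec \<Rightarrow> complex" where
  "complex_extension w p = (\<lambda>(u, v) (u', v').
     (w p u u' - w p v v') + \<i> * (w p u v' + w p v u'))"

text \<open>Type \<open>(r, s)\<close>: the complex bilinear extension vanishes on arguments of pure type unless
  exactly \<open>r\<close> of them are in \<open>T\<^sup>1\<^sup>,\<^sup>0\<close> and \<open>s\<close> of them are in \<open>T\<^sup>0\<^sup>,\<^sup>1\<close>.\<close>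

definition of_type :: "nat \<Rightarrow> nat \<Rightarrow> ('m, 'n, complex) form2 \<Rightarrow> bool" where
  "of_type r s w \<longleftrightarrow>
     (\<forall>p\<in>topspace M. \<forall>k\<in>{0, 1}. \<forall>l\<in>{0, 1}.
        \<forall>Z\<in>tangent_type k p. \<forall>W\<in>tangent_type l p.
          (k + l, (1 - k) + (1 - l)) \<noteq> (r, s) \<longrightarrow> complex_extension w p Z W = 0)"

definition hodge_decomposition :: "('m, 'n, real) form2 \<Rightarrow> ('m, 'n, complex) form2 \<Rightarrow>
    ('m, 'n, complex) form2 \<Rightarrow> ('m, 'n, complex) form2 \<Rightarrow> bool" where
  "hodge_decomposition w w11 w20 w02 \<longleftrightarrow>
     two_form w11 \<and> two_form w20 \<and> two_form w02 \<and>
     of_type 1 1 w11 \<and> of_type 2 0 w20 \<and> of_type 0 2 w02 \<and>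
     (\<forall>p\<in>topspace M. \<forall>u\<in>tangent_space p. \<forall>v\<in>tangent_space p.
        complex_of_real (w p u v) = w11 p u v + w20 p u v + w02 p u v)"


subsection \<open>Connections on the real tangent bundle\<close>

definition connection :: "(('m, 'n) vfield \<Rightarrow> ('m, 'n) vfield \<Rightarrow> ('m, 'n) vfield) \<Rightarrow> bool" where
  "connection nabla \<longleftrightarrow>
     (\<forall>X\<in>vector_fields. \<forall>Y\<in>vector_fields. nabla X Y \<in> vector_fields) \<and>
     (\<forall>X\<in>vector_fields. \<forall>X'\<in>vector_fields. \<forall>Y\<in>vector_fields.
        nabla (vf_add X X') Y = vf_add (nabla X Y) (nabla X' Y)) \<and>
     (\<forall>f. \<forall>X\<in>vector_fields. \<forall>Y\<in>vector_fields. smooth_function f \<longrightarrow>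
        nabla (vf_scale f X) Y = vf_scale f (nabla X Y)) \<and>
     (\<forall>X\<in>vector_fields. \<forall>Y\<in>vector_fields. \<forall>Y'\<in>vector_fields.
        nabla X (vf_add Y Y') = vf_add (nabla X Y) (nabla X Y')) \<and>
     (\<forall>f. \<forall>X\<in>vector_fields. \<forall>Y\<in>vector_fields. smooth_function f \<longrightarrow>
        nabla X (vf_scale f Y) = vf_add (vf_scale (vf_deriv X f) Y) (vf_scale f (nabla X Y)))"

definition torsionfree :: "(('m, 'n) vfield \<Rightarrow> ('m, 'n) vfield \<Rightarrow> ('m, 'n) vfield) \<Rightarrow> bool" where
  "torsionfree nabla \<longleftrightarrow>
     (\<forall>X\<in>vector_fields. \<forall>Y\<in>vector_fields.
        vf_diff (nabla X Y) (nabla Y X) = lie_bracket X Y)"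

definition flat :: "(('m, 'n) vfield \<Rightarrow> ('m, 'n) vfield \<Rightarrow> ('m, 'n) vfield) \<Rightarrow> bool" where
  "flat nabla \<longleftrightarrow>
     (\<forall>X\<in>vector_fields. \<forall>Y\<in>vector_fields. \<forall>Z\<in>vector_fields.
        vf_diff (vf_diff (nabla X (nabla Y Z)) (nabla Y (nabla X Z))) (nabla (lie_bracket X Y) Z)
          = vf_zero)"

text \<open>\<open>(\<nabla>\<^sub>X J) Y = \<nabla>\<^sub>X (J Y) - J (\<nabla>\<^sub>X Y)\<close>\<close>

definition nabla_J :: "(('m, 'n) vfield \<Rightarrow> ('m, 'n) vfield \<Rightarrow> ('m, 'n) vfield) \<Rightarrow>
    ('m, 'n) vfield \<Rightarrow> ('m, 'n) vfield \<Rightarrow> ('m, 'n) vfield" where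
  "nabla_J nabla X Y = vf_diff (nabla X (vf_J Y)) (vf_J (nabla X Y))"

definition parallel_form :: "(('m, 'n) vfield \<Rightarrow> ('m, 'n) vfield \<Rightarrow> ('m, 'n) vfield) \<Rightarrow>
    ('m, 'n, real) form2 \<Rightarrow> bool" where
  "parallel_form nabla w \<longleftrightarrow>
     (\<forall>X\<in>vector_fields. \<forall>Y\<in>vector_fields. \<forall>Z\<in>vector_fields. \<forall>p\<in>topspace M.
        vf_deriv X (\<lambda>q. w q (Y q) (Z q)) p - w p (nabla X Y p) (Z p) - w p (Y p) (nabla X Z p) = 0)"

end


section \<open>Special symplectic manifolds\<close>

locale special_symplectic_manifold = complex_manifold M A
  for M :: "'m topology" and A :: "('m, 'n::finite) chart set" +
  fixes nabla :: "('m, 'n) vfield \<Rightarrow> ('m, 'n) vfield \<Rightarrow> ('m, 'n) vfield"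
    and w :: "('m, 'n, real) form2"
  assumes connection: "connection nabla"
    and flat: "flat nabla"
    and torsionfree: "torsionfree nabla"
    and d_nabla_J: "X \<in> vector_fields \<Longrightarrow> Y \<in> vector_fields \<Longrightarrow> nabla_J nabla X Y = nabla_J nabla Y X"
    and symplectic: "symplectic_form w"
    and parallel: "parallel_form nabla w"

end

theory Submission
  imports Defs
begin

text \<open>Symmetry of \<open>\<nabla>J\<close> together with vanishing torsion gives
  \<open>\<nabla>\<^sub>X (J Y) - \<nabla>\<^sub>Y (J X) = J [X, Y]\<close>.  Since \<open>\<omega>\<close> is parallel, expanding the exterior
  derivatives of the real 2-forms \<open>\<omega>(J \<cdot>, J \<cdot>)\<close> and \<open>\<omega>(J \<cdot>, \<cdot>) + \<omega>(\<cdot>, J \<cdot>)\<close> in terms of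
  \<open>\<nabla>\<close> then makes all terms cancel, so both are closed.  The Hodge components of \<open>\<omega>\<close> are
  constant complex linear combinations of \<open>\<omega>\<close> and these two forms.\<close>

section \<open>Smooth maps between open sets of vector spaces\<close>

lemma Ck_on_cong:
  assumes "open S" "\<And>x. x \<in> S \<Longrightarrow> f x = g x" "Ck_on k f S"
  shows "Ck_on k g S"
  using assms(2,3)
proof (induction k arbitrary: f g)
  case 0
  then show ?case by (metis Ck_on.simps(1) continuous_on_cong)
next
  case (Suc k)
  \<comment> \<open>Agreement on \<open>S\<close> passes to derivatives because the open set
    \<open>S\<close> is a neighbourhood of each of its points.\<close>
  have deriv: "(g has_derivative frechet_derivative f (at x)) (at x)" if "x \<in> S" for x
  proof -
    have "(f has_derivative frechet_derivative f (at x)) (at x)"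
      using Suc.prems(2) that by (auto simp: frechet_derivative_works)
    then show ?thesis
      by (rule has_derivative_transform_within_open[OF _ assms(1) that]) (rule Suc.prems(1))
  qed
  have "frechet_derivative g (at x) = frechet_derivative f (at x)" if "x \<in> S" for x
    using frechet_derivative_at[OF deriv[OF that]] by simp
  with Suc.prems(2) have "Ck_on k (\<lambda>x. frechet_derivative g (at x) v) S" for v
    by - (rule Suc.IH[where f = "\<lambda>x. frechet_derivative f (at x) v"], auto)
  with deriv show ?case
    by (auto simp: differentiable_def)
qed

text \<open>A bounded linear map commutes with differentiation, so the induction stays within maps
  of the form \<open>L\<close> after \<open>f\<close>. It is needed for \<open>L\<close> =
  multiplication by the imaginary unit, to see that \<open>J X\<close> is smooth.\<close>

lemma Ck_on_bounded_linear:
  assumes "open S" "bounded_linear L" "Ck_on k f S"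
  shows "Ck_on k (\<lambda>x. L (f x)) S"
  using assms(3)
proof (induction k arbitrary: f)
  case 0
  then show ?case by (simp add: bounded_linear.continuous_on[OF assms(2)])
next
  case (Suc k)
  have deriv: "((\<lambda>x. L (f x)) has_derivative (\<lambda>v. L (frechet_derivative f (at x) v))) (at x)"
    if "x \<in> S" for x
    using Suc.prems that
    by (intro bounded_linear.has_derivative[OF assms(2)]) (auto simp: frechet_derivative_works)
  have "Ck_on k (\<lambda>x. frechet_derivative (\<lambda>x. L (f x)) (at x) v) S" for v
  proof (rule Ck_on_cong[OF assms(1)])
    show "Ck_on k (\<lambda>x. L (frechet_derivative f (at x) v)) S"
      using Suc.prems by (intro Suc.IH) auto
  qed (simp add: frechet_derivative_at[OF deriv, symmetric])
  with deriv show ?case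
    by (auto simp: differentiable_def)
qed

lemma smooth_on_bounded_linear:
  "open S \<Longrightarrow> bounded_linear L \<Longrightarrow> smooth_on f S \<Longrightarrow> smooth_on (\<lambda>x. L (f x)) S"
  by (simp add: smooth_on_def Ck_on_bounded_linear)

lemma smooth_on_differentiable: "smooth_on f S \<Longrightarrow> x \<in> S \<Longrightarrow> f differentiable (at x)"
  unfolding smooth_on_def by (drule spec[of _ "Suc 0"]) simp

lemma bounded_linear_vector_scalar_mult: "bounded_linear (\<lambda>v::complex^'n. c *s v)"
  by (intro linear_conv_bounded_linear[THEN iffD1] linearI)
     (auto simp: vec_eq_iff algebra_simps)

context complex_manifold
begin

section \<open>Charts, tangent vectors and the complex structure\<close>

lemma chart_inv_inverse:
  assumes "c \<in> A" "p \<in> chart_dom c"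
  shows "chart_inv c (chart_map c p) = p"
proof -
  have "openin M (chart_dom c)"
    and "homeomorphic_map (subtopology M (chart_dom c)) (top_of_set (chart_img c)) (chart_map c)"
    using charts[OF assms(1)] by (auto simp: is_chart_def)
  then have "inj_on (chart_map c) (chart_dom c)"
    using homeomorphic_imp_injective_map topspace_subtopology_subset[OF openin_subset] by metis
  then show ?thesis
    using assms(2) by (simp add: chart_inv_def inv_into_f_f)
qed

lemma chart_inv_in_topspace: "c \<in> A \<Longrightarrow> x \<in> chart_img c \<Longrightarrow> chart_inv c x \<in> topspace M"
  using cover by (auto simp: chart_img_def chart_inv_inverse)

lemma open_chart_img: "c \<in> A \<Longrightarrow> open (chart_img c)"
  using charts by (auto simp: is_chart_def)

text \<open>Holomorphy provides some complex linear derivative, and uniqueness identifies it with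
  \<open>frechet_derivative\<close>. Complex linearity is what makes \<open>tv_J\<close> compatible
  with coordinate changes.\<close>

lemma transition_derivative:
  assumes "c \<in> A" "d \<in> A" "p \<in> chart_dom c" "p \<in> chart_dom d"
  defines "D \<equiv> frechet_derivative (chart_map d \<circ> chart_inv c) (at (chart_map c p))"
  shows "linear D" "D (z *s v) = z *s D v"
proof -
  obtain D' where D': "(chart_map d \<circ> chart_inv c has_derivative D') (at (chart_map c p))"
      "\<And>z v. D' (z *s v) = z *s D' v"
    using holomorphic_transition[OF assms(1,2)] assms(3,4)
    unfolding holomorphic_map_on_def by blast
  moreover have "D = D'"
    unfolding D_def using frechet_derivative_at[OF D'(1)] by simp
  ultimately show "linear D" "D (z *s v) = z *s D v"
    using has_derivative_linear by auto
qed

lemma tangent_spaceI: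
  assumes "\<And>c d. c \<in> A \<Longrightarrow> d \<in> A \<Longrightarrow> p \<in> chart_dom c \<Longrightarrow> p \<in> chart_dom d \<Longrightarrow>
      v d = frechet_derivative (chart_map d \<circ> chart_inv c) (at (chart_map c p)) (v c)"
    and "\<And>c. \<not> (c \<in> A \<and> p \<in> chart_dom c) \<Longrightarrow> v c = 0"
  shows "v \<in> tangent_space p"
  unfolding tangent_space_def using assms by blast

lemma tangent_space_transition:
  assumes "v \<in> tangent_space p" "c \<in> A" "d \<in> A" "p \<in> chart_dom c" "p \<in> chart_dom d"
  shows "frechet_derivative (chart_map d \<circ> chart_inv c) (at (chart_map c p)) (v c) = v d"
proof (rule sym)
  show "v d = frechet_derivative (chart_map d \<circ> chart_inv c) (at (chart_map c p)) (v c)"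
    using assms unfolding tangent_space_def by blast
qed

lemma tangent_space_outside:
  "v \<in> tangent_space p \<Longrightarrow> \<not> (c \<in> A \<and> p \<in> chart_dom c) \<Longrightarrow> v c = 0"
  unfolding tangent_space_def by blast

lemma tangent_space_add:
  assumes "u \<in> tangent_space p" "v \<in> tangent_space p"
  shows "tv_add u v \<in> tangent_space p"
  by (rule tangent_spaceI)
     (simp_all add: tv_add_def linear_add[OF transition_derivative(1)]
       tangent_space_transition[OF assms(1)] tangent_space_transition[OF assms(2)]
       tangent_space_outside[OF assms(1)] tangent_space_outside[OF assms(2)])

lemma tangent_space_scale:
  assumes "u \<in> tangent_space p"
  shows "tv_scale r u \<in> tangent_space p"
  by (rule tangent_spaceI)
     (simp_all add: tv_scale_def linear_scale[OF transition_derivative(1)]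
       tangent_space_transition[OF assms] tangent_space_outside[OF assms])

lemma tangent_space_J:
  assumes "u \<in> tangent_space p"
  shows "tv_J u \<in> tangent_space p"
  by (rule tangent_spaceI)
     (simp_all add: tv_J_def transition_derivative(2)
       tangent_space_transition[OF assms] tangent_space_outside[OF assms])

lemma vector_fields_tangent: "X \<in> vector_fields \<Longrightarrow> p \<in> topspace M \<Longrightarrow> X p \<in> tangent_space p"
  by (simp add: vector_fields_def)

lemma vector_fields_J:
  assumes "X \<in> vector_fields"
  shows "vf_J X \<in> vector_fields"
proof -
  have "smooth_on (\<lambda>x. vf_J X (chart_inv c x) c) (chart_img c)" if "c \<in> A" for c
  proof -
    have "smooth_on (\<lambda>x. X (chart_inv c x) c) (chart_img c)"
      using assms that by (simp add: vector_fields_def)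
    from smooth_on_bounded_linear[OF open_chart_img[OF that] bounded_linear_vector_scalar_mult this]
    show ?thesis
      unfolding vf_J_def tv_J_def .
  qed
  \<comment> \<open>Vector fields are extended by zero outside the manifold, and \<open>J\<close>
    has to preserve this convention.\<close>
  moreover have "tv_J (tv_zero :: ('m, 'n) tvec) = tv_zero"
    by (simp add: tv_J_def tv_zero_def)
  ultimately show ?thesis
    using assms by (simp add: vector_fields_def) (simp add: vf_J_def tangent_space_J)
qed

section \<open>Derivatives of functions along vector fields\<close>

lemma vf_deriv_eq:
  assumes p: "p \<in> topspace M"
    and D: "\<And>c. c \<in> A \<Longrightarrow> p \<in> chart_dom c \<Longrightarrow>
      (f \<circ> chart_inv c has_derivative D c) (at (chart_map c p))"
  shows "vf_deriv X f p = (let c = (SOME c. c \<in> A \<and> p \<in> chart_dom c) in D c (X p c))"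
proof -
  have "\<exists>c. c \<in> A \<and> p \<in> chart_dom c"
    using p cover by auto
  then have "(SOME c. c \<in> A \<and> p \<in> chart_dom c) \<in> A \<and>
      p \<in> chart_dom (SOME c. c \<in> A \<and> p \<in> chart_dom c)"
    by (rule someI_ex)
  then show ?thesis
    using frechet_derivative_at[OF D, of "SOME c. c \<in> A \<and> p \<in> chart_dom c"]
    by (simp add: vf_deriv_def)
qed

lemma smooth_function_has_derivative:
  assumes "smooth_function f" "c \<in> A" "p \<in> chart_dom c"
  shows "(f \<circ> chart_inv c has_derivative frechet_derivative (f \<circ> chart_inv c) (at (chart_map c p)))
    (at (chart_map c p))"
  using assms smooth_on_differentiable[of "f \<circ> chart_inv c" "chart_img c"]
  by (auto simp: smooth_function_def chart_img_def frechet_derivative_works[symmetric])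

text \<open>All five derivatives are computed in the same chosen chart, so linearity of the Frechet
  derivative suffices and no independence of the chart enters. The four terms are those of
  \<open>closed_form_combination\<close>.\<close>

lemma vf_deriv_combination:
  fixes g1 g2 g3 g4 :: "'m \<Rightarrow> real" and f :: "'m \<Rightarrow> complex"
  assumes p: "p \<in> topspace M"
    and smooth: "smooth_function g1" "smooth_function g2" "smooth_function g3" "smooth_function g4"
    and f: "\<And>q. q \<in> topspace M \<Longrightarrow>
      f q = a1 * of_real (g1 q) + a2 * of_real (g2 q) + a3 * of_real (g3 q) + a4 * of_real (g4 q)"
  shows "vf_deriv X f p = a1 * of_real (vf_deriv X g1 p) + a2 * of_real (vf_deriv X g2 p)
    + a3 * of_real (vf_deriv X g3 p) + a4 * of_real (vf_deriv X g4 p)"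
proof -
  define D where "D = (\<lambda>(g :: 'm \<Rightarrow> real) (c :: ('m, 'n) chart).
    frechet_derivative (g \<circ> chart_inv c) (at (chart_map c p)))"
  have "(f \<circ> chart_inv c has_derivative (\<lambda>v. a1 * of_real (D g1 c v) + a2 * of_real (D g2 c v)
      + a3 * of_real (D g3 c v) + a4 * of_real (D g4 c v))) (at (chart_map c p))"
    if c: "c \<in> A" "p \<in> chart_dom c" for c
  proof -
    have g: "((\<lambda>x. g (chart_inv c x)) has_derivative D g c) (at (chart_map c p))"
      if "smooth_function g" for g
      using smooth_function_has_derivative[OF that c] by (simp add: D_def comp_def)
    have "((\<lambda>x. a1 * of_real (g1 (chart_inv c x)) + a2 * of_real (g2 (chart_inv c x))
      + a3 * of_real (g3 (chart_inv c x)) + a4 * of_real (g4 (chart_inv c x))) has_derivative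
      (\<lambda>v. a1 * of_real (D g1 c v) + a2 * of_real (D g2 c v)
      + a3 * of_real (D g3 c v) + a4 * of_real (D g4 c v))) (at (chart_map c p))"
      by (intro has_derivative_add has_derivative_mult_right has_derivative_of_real g smooth)
    \<comment> \<open>The formula for \<open>f\<close> holds only on the manifold, but
      \<open>chart_inv c\<close> maps the open set \<open>chart_img c\<close> there, so both sides
      agree near \<open>chart_map c p\<close>.\<close>
    then show ?thesis
      by (rule has_derivative_transform_within_open[OF _ open_chart_img[OF c(1)]])
         (use c in \<open>auto simp: chart_img_def f chart_inv_in_topspace[OF c(1)]\<close>)
  qed
  note f_deriv = vf_deriv_eq[OF p this]
  have "vf_deriv X g p = (let c = (SOME c. c \<in> A \<and> p \<in> chart_dom c) in D g c (X p c))"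
    for g :: "'m \<Rightarrow> real"
    by (simp add: vf_deriv_def D_def)
  with f_deriv show ?thesis
    by (simp add: Let_def)
qed

section \<open>Algebra of 2-forms and their Hodge types\<close>

lemma two_form_skew:
  "two_form w \<Longrightarrow> p \<in> topspace M \<Longrightarrow> u \<in> tangent_space p \<Longrightarrow> v \<in> tangent_space p \<Longrightarrow>
    w p u v = - w p v u"
  unfolding two_form_def by blast

lemma two_form_scale_left:
  "two_form w \<Longrightarrow> p \<in> topspace M \<Longrightarrow> u \<in> tangent_space p \<Longrightarrow> v \<in> tangent_space p \<Longrightarrow>
    w p (tv_scale r u) v = r *\<^sub>R w p u v"
  unfolding two_form_def by blast

lemma two_form_diff_left:
  assumes "two_form w" "p \<in> topspace M" "u \<in> tangent_space p" "u' \<in> tangent_space p"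
    "v \<in> tangent_space p"
  shows "w p (tv_add u (tv_scale (-1) u')) v = w p u v - w p u' v"
proof -
  have "w p (tv_add u (tv_scale (-1) u')) v = w p u v + w p (tv_scale (-1) u') v"
    using assms tangent_space_scale unfolding two_form_def by blast
  then show ?thesis
    using assms by (simp add: two_form_scale_left)
qed

lemma two_form_scale_right:
  assumes "two_form w" "p \<in> topspace M" "u \<in> tangent_space p" "v \<in> tangent_space p"
  shows "w p u (tv_scale r v) = r *\<^sub>R w p u v"
  using two_form_skew[OF assms] two_form_skew[OF assms(1-3) tangent_space_scale[OF assms(4)]]
    two_form_scale_left[OF assms(1,2,4,3)] by simp

lemma of_type_complex_extension:
  assumes "of_type r s w" "p \<in> topspace M" "k \<in> {0, 1}" "l \<in> {0, 1}"
    "Z \<in> tangent_type k p" "W \<in> tangent_type l p" "(k + l, (1 - k) + (1 - l)) \<noteq> (r, s)"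
  shows "complex_extension w p Z W = 0"
  using assms unfolding of_type_def by blast

text \<open>The sign -1 for \<open>r\<close> or \<open>s\<close> gives a vector of type (1,0) and
  the sign 1 one of type (0,1), so a single formula covers all four combinations of types.\<close>

lemma complex_extension_tangent_type:
  assumes w: "two_form w" and p: "p \<in> topspace M"
    and u: "u \<in> tangent_space p" and v: "v \<in> tangent_space p"
  shows "complex_extension w p (u, tv_scale r (tv_J u)) (v, tv_scale s (tv_J v)) =
    w p u v - r * s * w p (tv_J u) (tv_J v) + \<i> * (s * w p u (tv_J v) + r * w p (tv_J u) v)"
proof -
  note J = tangent_space_J[OF u] tangent_space_J[OF v]
  show ?thesis
    using u v J
    by (simp add: complex_extension_def two_form_scale_left[OF w p] two_form_scale_right[OF w p]
        tangent_space_scale scaleR_conv_of_real algebra_simps)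
qed

lemma tangent_type_scale:
  assumes "u \<in> tangent_space p"
  shows "(u, tv_scale (-1) (tv_J u)) \<in> tangent_type 1 p"
    and "(u, tv_scale 1 (tv_J u)) \<in> tangent_type 0 p"
  using assms by (auto simp: tangent_type_def tv_scale_def)

text \<open>Vanishing of the complex extension on the excluded types is a linear system in the
  values of \<open>w\<close> at \<open>(u, v)\<close>, \<open>(J u, J v)\<close>,
  \<open>(u, J v)\<close> and \<open>(J u, v)\<close>. Solving it expresses the action of
  \<open>J\<close> on a form of each type.\<close>

lemma
  assumes w: "two_form w" and p: "p \<in> topspace M"
    and u: "u \<in> tangent_space p" and v: "v \<in> tangent_space p"
  shows type_11_J: "of_type 1 1 w \<Longrightarrow> w p (tv_J u) (tv_J v) = w p u v"
      "of_type 1 1 w \<Longrightarrow> w p u (tv_J v) = - w p (tv_J u) v"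
    and type_20_J: "of_type 2 0 w \<Longrightarrow> w p (tv_J u) v = \<i> * w p u v"
      "of_type 2 0 w \<Longrightarrow> w p u (tv_J v) = \<i> * w p u v"
      "of_type 2 0 w \<Longrightarrow> w p (tv_J u) (tv_J v) = - w p u v"
    and type_02_J: "of_type 0 2 w \<Longrightarrow> w p (tv_J u) v = - \<i> * w p u v"
      "of_type 0 2 w \<Longrightarrow> w p u (tv_J v) = - \<i> * w p u v"
      "of_type 0 2 w \<Longrightarrow> w p (tv_J u) (tv_J v) = - w p u v"
proof -
  note ext = complex_extension_tangent_type[OF w p u v]
  note tt = tangent_type_scale[OF u] tangent_type_scale[OF v]
  let ?a = "w p u v" and ?b = "w p (tv_J u) (tv_J v)"
    and ?c = "w p u (tv_J v)" and ?d = "w p (tv_J u) v"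
  \<comment> \<open>\<open>E\<close> and \<open>F\<close> come from two arguments of type (1,0) and
    of type (0,1) respectively; \<open>G\<close> and \<open>H\<close> come from the two mixed
    orders. Each is available unless the form is of exactly that type.\<close>
  have E: "?a - ?b - \<i> * (?c + ?d) = 0" if "of_type r s w" "(r, s) \<noteq> (2, 0)" for r s
    using of_type_complex_extension[OF that(1) p _ _ tt(1) tt(3)] that(2) ext[of "-1" "-1"]
    by (auto simp: algebra_simps)
  have F: "?a - ?b + \<i> * (?c + ?d) = 0" if "of_type r s w" "(r, s) \<noteq> (0, 2)" for r s
    using of_type_complex_extension[OF that(1) p _ _ tt(2) tt(4)] that(2) ext[of 1 1]
    by (auto simp: algebra_simps)
  have G: "?a + ?b + \<i> * (?c - ?d) = 0" if "of_type r s w" "(r, s) \<noteq> (1, 1)" for r s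
    using of_type_complex_extension[OF that(1) p _ _ tt(1) tt(4)] that(2) ext[of "-1" 1]
    by (auto simp: algebra_simps)
  have H: "?a + ?b - \<i> * (?c - ?d) = 0" if "of_type r s w" "(r, s) \<noteq> (1, 1)" for r s
    using of_type_complex_extension[OF that(1) p _ _ tt(2) tt(3)] that(2) ext[of 1 "-1"]
    by (auto simp: algebra_simps)
  {
    assume "of_type 1 1 w"
    note E[OF this] F[OF this]
    then show "?b = ?a" "?c = - ?d"
      by (auto simp: complex_eq_iff)
  next
    assume "of_type 2 0 w"
    note F[OF this] G[OF this] H[OF this]
    then show "?d = \<i> * ?a" "?c = \<i> * ?a" "?b = - ?a"
      by (auto simp: complex_eq_iff)
  next
    assume "of_type 0 2 w"
    note E[OF this] G[OF this] H[OF this]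
    then show "?d = - \<i> * ?a" "?c = - \<i> * ?a" "?b = - ?a"
      by (auto simp: complex_eq_iff)
  }
qed

text \<open>Replacing \<open>u\<close> and \<open>v\<close> by \<open>J u\<close> and
  \<open>J v\<close> in the decomposition, separately and together, gives enough equations to
  isolate each component.\<close>

lemma hodge_components:
  assumes "hodge_decomposition w w11 w20 w02"
    and p: "p \<in> topspace M" and u: "u \<in> tangent_space p" and v: "v \<in> tangent_space p"
  shows "w11 p u v = (of_real (w p u v) + of_real (w p (tv_J u) (tv_J v))) / 2"
    and "w20 p u v = (of_real (w p u v) - of_real (w p (tv_J u) (tv_J v))
      - \<i> * (of_real (w p (tv_J u) v) + of_real (w p u (tv_J v)))) / 4"
    and "w02 p u v = (of_real (w p u v) - of_real (w p (tv_J u) (tv_J v))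
      + \<i> * (of_real (w p (tv_J u) v) + of_real (w p u (tv_J v)))) / 4"
proof -
  have forms: "two_form w11" "two_form w20" "two_form w02"
    and types: "of_type 1 1 w11" "of_type 2 0 w20" "of_type 0 2 w02"
    and sum: "\<And>u v. u \<in> tangent_space p \<Longrightarrow> v \<in> tangent_space p \<Longrightarrow>
      complex_of_real (w p u v) = w11 p u v + w20 p u v + w02 p u v"
    using assms unfolding hodge_decomposition_def by auto
  note J = type_11_J[OF forms(1) p u v types(1)] type_20_J[OF forms(2) p u v types(2)]
    type_02_J[OF forms(3) p u v types(3)]
  note sums = sum[OF u v] sum[OF tangent_space_J[OF u] v] sum[OF u tangent_space_J[OF v]]
    sum[OF tangent_space_J[OF u] tangent_space_J[OF v]]
  \<comment> \<open>Four equations in the unknowns \<open>w11 p u v\<close>,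
    \<open>w20 p u v\<close>, \<open>w02 p u v\<close> and \<open>w11 p (tv_J u) v\<close>; the last
    one cancels when the two mixed equations are added.\<close>
  have S: "complex_of_real (w p u v) = w11 p u v + w20 p u v + w02 p u v"
    "complex_of_real (w p (tv_J u) (tv_J v)) = w11 p u v - w20 p u v - w02 p u v"
    "complex_of_real (w p (tv_J u) v) = w11 p (tv_J u) v + \<i> * w20 p u v - \<i> * w02 p u v"
    "complex_of_real (w p u (tv_J v)) = - w11 p (tv_J u) v + \<i> * w20 p u v - \<i> * w02 p u v"
    using sums J by simp_all
  show "w11 p u v = (of_real (w p u v) + of_real (w p (tv_J u) (tv_J v))) / 2"
    unfolding S by simp
  show "w20 p u v = (of_real (w p u v) - of_real (w p (tv_J u) (tv_J v))
      - \<i> * (of_real (w p (tv_J u) v) + of_real (w p u (tv_J v)))) / 4"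
    unfolding S by (simp add: field_simps)
  show "w02 p u v = (of_real (w p u v) - of_real (w p (tv_J u) (tv_J v))
      + \<i> * (of_real (w p (tv_J u) v) + of_real (w p u (tv_J v)))) / 4"
    unfolding S by (simp add: field_simps)
qed

end

context special_symplectic_manifold
begin

section \<open>Closedness from the flat torsionfree connection\<close>

lemma two_form_w: "two_form w"
  using symplectic by (simp add: symplectic_form_def)

lemma nabla_vector_fields: "X \<in> vector_fields \<Longrightarrow> Y \<in> vector_fields \<Longrightarrow> nabla X Y \<in> vector_fields"
  using connection by (simp add: connection_def)

lemma lie_bracket_nabla:
  assumes "X \<in> vector_fields" "Y \<in> vector_fields"
  shows "lie_bracket X Y p = tv_add (nabla X Y p) (tv_scale (-1) (nabla Y X p))"
proof -
  have "vf_diff (nabla X Y) (nabla Y X) = lie_bracket X Y"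
    using torsionfree assms unfolding torsionfree_def by blast
  from this[symmetric] show ?thesis
    by (simp add: vf_diff_def)
qed

lemma lie_bracket_tangent:
  assumes "X \<in> vector_fields" "Y \<in> vector_fields" "p \<in> topspace M"
  shows "lie_bracket X Y p \<in> tangent_space p"
  unfolding lie_bracket_nabla[OF assms(1,2)] using assms
  by (intro tangent_space_add tangent_space_scale vector_fields_tangent nabla_vector_fields)

text \<open>In the symmetry of \<open>nabla_J\<close>, collect the two terms
  \<open>J (nabla X Y)\<close> and \<open>J (nabla Y X)\<close> on one side: by vanishing torsion
  their difference is \<open>J [X, Y]\<close>.\<close>

lemma J_lie_bracket_nabla:
  assumes "X \<in> vector_fields" "Y \<in> vector_fields"
  shows "tv_J (lie_bracket X Y p) = tv_add (nabla X (vf_J Y) p) (tv_scale (-1) (nabla Y (vf_J X) p))"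
proof
  fix c
  have "nabla_J nabla X Y p c = nabla_J nabla Y X p c"
    using d_nabla_J[OF assms] by simp
  then show "tv_J (lie_bracket X Y p) c =
      tv_add (nabla X (vf_J Y) p) (tv_scale (-1) (nabla Y (vf_J X) p)) c"
    by (simp add: lie_bracket_nabla[OF assms] nabla_J_def vf_diff_def vf_J_def tv_J_def tv_add_def
        tv_scale_def vec_eq_iff algebra_simps)
qed

text \<open>Skew symmetry moves \<open>nabla\<close> into the first slot of \<open>w\<close>
  throughout, the same normal form as in \<open>w_lie_bracket\<close>, so that later cancellation is
  purely syntactic.\<close>

lemma vf_deriv_w:
  assumes "X \<in> vector_fields" "Y \<in> vector_fields" "Z \<in> vector_fields" "p \<in> topspace M"
  shows "vf_deriv X (\<lambda>q. w q (Y q) (Z q)) p = w p (nabla X Y p) (Z p) - w p (nabla X Z p) (Y p)"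
proof -
  have "vf_deriv X (\<lambda>q. w q (Y q) (Z q)) p - w p (nabla X Y p) (Z p) - w p (Y p) (nabla X Z p) = 0"
    using parallel assms unfolding parallel_form_def by blast
  moreover have "w p (Y p) (nabla X Z p) = - w p (nabla X Z p) (Y p)"
    using assms by (intro two_form_skew two_form_w vector_fields_tangent nabla_vector_fields)
  ultimately show ?thesis
    by simp
qed

lemma w_lie_bracket:
  assumes "X \<in> vector_fields" "Y \<in> vector_fields" "p \<in> topspace M" "v \<in> tangent_space p"
  shows "w p (lie_bracket X Y p) v = w p (nabla X Y p) v - w p (nabla Y X p) v"
    and "w p (tv_J (lie_bracket X Y p)) v = w p (nabla X (vf_J Y) p) v - w p (nabla Y (vf_J X) p) v"
  \<comment> \<open>This rewriting has to come first: expanding the bare bracket would destroy the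
    pattern \<open>tv_J (lie_bracket X Y p)\<close>.\<close>
  unfolding J_lie_bracket_nabla[OF assms(1,2)]
  unfolding lie_bracket_nabla[OF assms(1,2)]
  using assms
  by (auto intro!: two_form_diff_left[OF two_form_w] vector_fields_tangent nabla_vector_fields
      vector_fields_J)

text \<open>The two mixed terms share the coefficient \<open>c\<close> because only their sum is
  skew: in the exterior derivative, derivative terms of one cancel against bracket terms of the
  other.\<close>

lemma closed_form_combination:
  fixes \<eta> :: "('m, 'n, complex) form2" and a b c :: complex
  assumes \<eta>: "\<And>p u v. p \<in> topspace M \<Longrightarrow> u \<in> tangent_space p \<Longrightarrow> v \<in> tangent_space p \<Longrightarrow>
    \<eta> p u v = a * w p u v + b * w p (tv_J u) (tv_J v) + c * w p (tv_J u) v + c * w p u (tv_J v)"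
  shows "closed_form \<eta>"
  unfolding closed_form_def
proof (intro ballI)
  fix X Y Z p
  assume X: "X \<in> vector_fields" and Y: "Y \<in> vector_fields" and Z: "Z \<in> vector_fields"
    and p: "p \<in> topspace M"
  have smooth: "smooth_function (\<lambda>q. w q (U q) (V q))"
    if "U \<in> vector_fields" "V \<in> vector_fields" for U V
    using two_form_w that unfolding two_form_def by blast
  have deriv: "vf_deriv U (\<lambda>q. \<eta> q (V q) (W q)) p =
      a * (w p (nabla U V p) (W p) - w p (nabla U W p) (V p))
      + b * (w p (nabla U (vf_J V) p) (tv_J (W p)) - w p (nabla U (vf_J W) p) (tv_J (V p)))
      + c * (w p (nabla U (vf_J V) p) (W p) - w p (nabla U W p) (tv_J (V p)))
      + c * (w p (nabla U V p) (tv_J (W p)) - w p (nabla U (vf_J W) p) (V p))"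
    if U: "U \<in> vector_fields" and V: "V \<in> vector_fields" and W: "W \<in> vector_fields" for U V W
  proof -
    note J = vector_fields_J[OF V] vector_fields_J[OF W]
    \<comment> \<open>Each summand is read as \<open>w\<close> on the fields \<open>V\<close>,
      \<open>W\<close> or their images under \<open>vf_J\<close>, so smoothness and parallelism of
      \<open>w\<close> itself apply.\<close>
    have "vf_deriv U (\<lambda>q. \<eta> q (V q) (W q)) p =
        a * of_real (vf_deriv U (\<lambda>q. w q (V q) (W q)) p)
        + b * of_real (vf_deriv U (\<lambda>q. w q (vf_J V q) (vf_J W q)) p)
        + c * of_real (vf_deriv U (\<lambda>q. w q (vf_J V q) (W q)) p)
        + c * of_real (vf_deriv U (\<lambda>q. w q (V q) (vf_J W q)) p)"
      by (rule vf_deriv_combination[OF p smooth[OF V W] smooth[OF J] smooth[OF J(1) W] smooth[OF V J(2)]])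
         (simp add: \<eta> vector_fields_tangent V W, simp add: vf_J_def)
    then show ?thesis
      using U V W J by (simp add: vf_deriv_w[OF _ _ _ p]) (simp add: vf_J_def)
  qed
  have bracket: "\<eta> p (lie_bracket U V p) (W p) =
      a * (w p (nabla U V p) (W p) - w p (nabla V U p) (W p))
      + b * (w p (nabla U (vf_J V) p) (tv_J (W p)) - w p (nabla V (vf_J U) p) (tv_J (W p)))
      + c * (w p (nabla U (vf_J V) p) (W p) - w p (nabla V (vf_J U) p) (W p))
      + c * (w p (nabla U V p) (tv_J (W p)) - w p (nabla V U p) (tv_J (W p)))"
    if U: "U \<in> vector_fields" and V: "V \<in> vector_fields" and W: "W \<in> vector_fields" for U V W
    using vector_fields_tangent[OF W p]
    by (simp add: \<eta>[OF p lie_bracket_tangent[OF U V p]] w_lie_bracket[OF U V p] tangent_space_J)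
  \<comment> \<open>Every value of \<open>w\<close> with a covariant derivative in the first slot
    occurs once in the derivative terms and once, with opposite sign, in the bracket terms.\<close>
  show "ext_deriv \<eta> X Y Z p = 0"
    by (simp add: ext_deriv_def deriv bracket X Y Z algebra_simps)
qed

end

theorem proposition4:
  fixes M :: "'m topology"
    and A :: "('m, 'n::finite) chart set"
    and nabla :: "('m, 'n) vfield \<Rightarrow> ('m, 'n) vfield \<Rightarrow> ('m, 'n) vfield"
    and \<omega> :: "('m, 'n, real) form2"
    and \<omega>11 \<omega>20 \<omega>02 :: "('m, 'n, complex) form2"
  assumes "special_symplectic_manifold M A nabla \<omega>"
    and "complex_manifold.hodge_decomposition M A \<omega> \<omega>11 \<omega>20 \<omega>02"
  shows "complex_manifold.closed_form M A \<omega>11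
    \<and> complex_manifold.closed_form M A \<omega>20
    \<and> complex_manifold.closed_form M A \<omega>02"
proof -
  interpret special_symplectic_manifold M A nabla \<omega>
    by (rule assms(1))
  note components = hodge_components[OF assms(2)]
  \<comment> \<open>The coefficients are read off from \<open>hodge_components\<close>; the types
    (2,0) and (0,2) differ only in the sign of \<open>c\<close>.\<close>
  have "closed_form \<omega>11"
    by (rule closed_form_combination[where a = "1/2" and b = "1/2" and c = 0])
       (simp add: components(1) add_divide_distrib)
  moreover have "closed_form \<omega>20"
    by (rule closed_form_combination[where a = "1/4" and b = "-1/4" and c = "-\<i>/4"])
       (simp add: components(2) field_simps)
  moreover have "closed_form \<omega>02"
    by (rule closed_form_combination[where a = "1/4" and b = "-1/4" and c = "\<i>/4"])
       (simp add: components(3) field_simps)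
  ultimately show ?thesis
    by blast
qed

end
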